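(* Let $X,Z\subset\mathbb{R}$ be compact, $\sigma_X\in\mathcal{P}(X)$, $\sigma_Z\in\mathcal{P}(Z)$, and $\bar z=\int z\,d\sigma_Z(z)$. Assume that $c\in C(X\times Z)$ is differentiable in $x$ and satisfies the martingale Spence–Mirrlees condition. If $\pi$ is optimal for the problem $$\min_{\pi\in\Pi^{\mathrm{Bar}}(F,\sigma_X,\sigma_Z)}\int c(x,z)\,d\pi(x,z),$$ where $F(x)=\bar z$ is the constant function, then $\pi$ is left-monotone.
   Context: $\mathcal{P}(X)$ is the set of Borel probability measures on $X$; $\Pi(\sigma_X,\sigma_Z)$ is the set of couplings of $\sigma_X$ and $\sigma_Z$. $\sigma_X\otimes\kappa$ denotes the joint measure with first marginal $\sigma_X$ and conditional probability kernel $\kappa$. For $F:X\to\mathbb{R}$, $\Pi^{\mathrm{Bar}}(F,\sigma_X,\sigma_Z)$ is the set of $\pi=\sigma_X\otimes\kappa_X^Z\in\Pi(\sigma_X,\sigma_Z)$ with $\int z\,\kappa_X^Z(x,dz)=F(x)$ for $\sigma_X$-a.e. $x$. Martingale Spence–Mirrlees condition: $\partial_x c(x,z)$ is strictly concave in $z$ for each $x$, or, more generally, $z\mapsto c(x',z)-c(x,z)$ is strictly concave on $Z$ for each $x<x'$ in $X$; the latter general form is the condition meant here (it follows from the former when $X$ is an interval). Strict concavity of $g$ on $Z$ means $g((1-\lambda)z^-+\lambda z^+)>(1-\lambda)g(z^-)+\lambda g(z^+)$ whenever $z^-<z^+$, $\lambda\in(0,1)$ and $z^-,z^+,(1-\lambda)z^-+\lambda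 z^+\in Z$. A set $\Gamma\subset\mathbb{R}^2$ is left-monotone if for any $(x,z^-),(x,z^+),(x',z')\in\Gamma$ with $z^-<z^+$ and $x<x'$, it holds that $z'\notin(z^-,z^+)$. A coupling $\pi\in\Pi(\sigma_X,\sigma_Z)$ is left-monotone if its support is left-monotone. *)

theory Defs
  imports "HOL-Probability.Probability"
begin

text \<open>Borel probability measures on \<open>X\<close>; the underlying space of the measure is \<open>X\<close> itself.\<close>

definition borel_probs :: "'a::topological_space set \<Rightarrow> 'a measure set" where
  "borel_probs X = space (prob_algebra (restrict_space borel X))"

definition couplings :: "'a measure \<Rightarrow> 'b measure \<Rightarrow> ('a \<times> 'b) measure set" where
  "couplings M N =
     {\<pi>. sets \<pi> = sets (M \<Otimes>\<^sub>M N) \<and> distr \<pi> M fst = M \<and> distr \<pi> N snd = N}"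

text \<open>The joint measure \<open>M \<otimes> \<kappa>\<close> on \<open>M \<Otimes>\<^sub>M N\<close>, that is,
  \<open>A \<mapsto> \<integral> \<kappa> x {z. (x, z) \<in> A} dM(x)\<close>.\<close>

definition kernel_joint ::
    "'a measure \<Rightarrow> 'b measure \<Rightarrow> ('a \<Rightarrow> 'b measure) \<Rightarrow> ('a \<times> 'b) measure" where
  "kernel_joint M N \<kappa> = M \<bind> (\<lambda>x. distr (\<kappa> x) (M \<Otimes>\<^sub>M N) (Pair x))"

definition barycentric_couplings ::
    "('a \<Rightarrow> real) \<Rightarrow> 'a measure \<Rightarrow> real measure \<Rightarrow> ('a \<times> real) measure set" where
  "barycentric_couplings F M N =
     {\<pi> \<in> couplings M N.
        \<exists>\<kappa> \<in> M \<rightarrow>\<^sub>M prob_algebra N.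
          \<pi> = kernel_joint M N \<kappa> \<and> (AE x in M. has_bochner_integral (\<kappa> x) (\<lambda>z. z) (F x))}"

text \<open>The set \<open>Z\<close> need not be convex; the library's \<^const>\<open>concave_on\<close> requires convexity
  of the domain.\<close>

definition strictly_concave_on_points :: "real set \<Rightarrow> (real \<Rightarrow> real) \<Rightarrow> bool" where
  "strictly_concave_on_points Z g \<longleftrightarrow>
     (\<forall>z1\<in>Z. \<forall>z2\<in>Z. \<forall>t. z1 < z2 \<and> 0 < t \<and> t < 1 \<and> (1 - t) * z1 + t * z2 \<in> Z \<longrightarrow>
        g ((1 - t) * z1 + t * z2) > (1 - t) * g z1 + t * g z2)"

definition martingale_spence_mirrlees ::
    "real set \<Rightarrow> real set \<Rightarrow> (real \<Rightarrow> real \<Rightarrow> real) \<Rightarrow> bool" where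
  "martingale_spence_mirrlees X Z c \<longleftrightarrow>
     (\<forall>x\<in>X. \<forall>x'\<in>X. x < x' \<longrightarrow> strictly_concave_on_points Z (\<lambda>z. c x' z - c x z))"

text \<open>The topological support, relative to the space of the measure. It agrees with the support
  in the ambient type when that space is closed.\<close>

definition measure_support :: "'a::topological_space measure \<Rightarrow> 'a set" where
  "measure_support M =
     {p \<in> space M. \<forall>U. open U \<and> p \<in> U \<longrightarrow> emeasure M (U \<inter> space M) > 0}"

definition left_monotone_set :: "(real \<times> real) set \<Rightarrow> bool" where
  "left_monotone_set \<Gamma> \<longleftrightarrow>
     (\<forall>x z1 z2 x' z'. (x, z1) \<in> \<Gamma> \<and> (x, z2) \<in> \<Gamma> \<and> (x', z') \<in> \<Gamma> \<and> z1 < z2 \<and> x < x' \<longrightarrow>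
        z' \<notin> {z1<..<z2})"

definition left_monotone :: "(real \<times> real) measure \<Rightarrow> bool" where
  "left_monotone \<pi> \<longleftrightarrow> left_monotone_set (measure_support \<pi>)"

end

theory Submission
  imports Defs
begin

text \<open>
  Let \<open>\<pi> = \<sigma>X \<otimes> \<kappa>\<close>, and draw \<open>(x, z1, z2)\<close> and \<open>(v, y1, y2)\<close> independently, each by
  choosing the first coordinate from \<open>\<sigma>X\<close> and then two independent points from its fibre.
  If \<open>x < v\<close> and \<open>y1\<close> lies strictly between \<open>z1\<close> and \<open>z2\<close>, swap \<open>z1\<close> and \<open>y1\<close> with
  probability equal to the weight of \<open>z1\<close> in \<open>y1\<close> as a convex combination of \<open>z1\<close> and \<open>z2\<close>;
  proceed symmetrically if \<open>v < x\<close>. The pairs (first coordinate, first fibre point) after the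
  swap are distributed according to a new coupling. Exchangeability of the two triples
  preserves the second marginal, exchangeability of the two points in a fibre preserves the
  barycentre of every fibre, and by the Spence--Mirrlees condition the cost strictly decreases
  unless crossings \<open>x < v\<close>, \<open>z1 < y1 < z2\<close> are null. So optimality excludes them almost surely.

  This does not by itself exclude crossings in the support, whose two points over the same \<open>x\<close>
  may be limits of points over different fibres. Here the constant barycentre \<open>m\<close> enters:
  if \<open>(x, z)\<close> and \<open>(x', z')\<close> are in the support with \<open>x < x'\<close> and \<open>m \<le> z' < z\<close>, then almost every
  fibre near \<open>x\<close> charging a neighbourhood of \<open>z\<close> also charges the points below \<open>m\<close>, so a crossing
  with the fibres near \<open>x'\<close> has positive probability. The case \<open>z < z' \<le> m\<close> is the mirror image.
\<close>

section \<open>Bounded measurable functions\<close>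

text \<open>This class is stable under sums, products and composition with measurable maps, and
  consists of integrable functions on any probability space. The side conditions of the Fubini steps
  below thus reduce to closure properties.\<close>

definition bounded_measurable :: "'a measure \<Rightarrow> ('a \<Rightarrow> real) \<Rightarrow> bool" where
  "bounded_measurable M f \<longleftrightarrow> f \<in> borel_measurable M \<and> (\<exists>B. \<forall>x\<in>space M. \<bar>f x\<bar> \<le> B)"

lemma bounded_measurableI:
  "f \<in> borel_measurable M \<Longrightarrow> (\<And>x. x \<in> space M \<Longrightarrow> \<bar>f x\<bar> \<le> B) \<Longrightarrow> bounded_measurable M f"
  by (auto simp: bounded_measurable_def)

lemma bounded_measurable_measurable [measurable_dest]:
  "bounded_measurable M f \<Longrightarrow> f \<in> borel_measurable M"
  by (simp add: bounded_measurable_def)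

lemma bounded_measurable_cong_sets:
  assumes "sets M = sets N"
  shows "bounded_measurable M f \<longleftrightarrow> bounded_measurable N f"
  using assms sets_eq_imp_space_eq[OF assms]
  by (simp add: bounded_measurable_def cong: measurable_cong_sets)

lemma bounded_measurable_integrable:
  assumes "prob_space M" and "bounded_measurable M f"
  shows "integrable M f"
proof -
  interpret prob_space M by fact
  from assms(2) obtain B where "f \<in> borel_measurable M" "\<forall>x\<in>space M. \<bar>f x\<bar> \<le> B"
    by (auto simp: bounded_measurable_def)
  then show ?thesis by (intro integrable_const_bound[where B = B]) auto
qed

lemma bounded_measurable_compose:
  assumes "g \<in> M \<rightarrow>\<^sub>M N" and "bounded_measurable N f"
  shows "bounded_measurable M (\<lambda>x. f (g x))"
  using assms measurable_space[OF assms(1)]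
  unfolding bounded_measurable_def by (blast intro: measurable_compose)

lemma bounded_measurable_mult:
  assumes "bounded_measurable M f" and "bounded_measurable M g"
  shows "bounded_measurable M (\<lambda>x. f x * g x)"
proof -
  from assms obtain A B where *: "f \<in> borel_measurable M" "g \<in> borel_measurable M"
    and "\<forall>x\<in>space M. \<bar>f x\<bar> \<le> A" "\<forall>x\<in>space M. \<bar>g x\<bar> \<le> B"
    by (auto simp: bounded_measurable_def)
  then have "\<bar>f x * g x\<bar> \<le> A * B" if "x \<in> space M" for x
    unfolding abs_mult using that by (intro mult_mono) (auto intro: order_trans[OF abs_ge_zero])
  with * show ?thesis by (intro bounded_measurableI) auto
qed

lemma bounded_measurable_add:
  assumes "bounded_measurable M f" and "bounded_measurable M g"
  shows "bounded_measurable M (\<lambda>x. f x + g x)"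
proof -
  from assms obtain A B where *: "f \<in> borel_measurable M" "g \<in> borel_measurable M"
    and "\<forall>x\<in>space M. \<bar>f x\<bar> \<le> A" "\<forall>x\<in>space M. \<bar>g x\<bar> \<le> B"
    by (auto simp: bounded_measurable_def)
  then have "\<bar>f x + g x\<bar> \<le> A + B" if "x \<in> space M" for x
    using that by (intro order_trans[OF abs_triangle_ineq] add_mono) auto
  with * show ?thesis by (intro bounded_measurableI) auto
qed

lemma bounded_measurable_minus:
  "bounded_measurable M f \<Longrightarrow> bounded_measurable M (\<lambda>x. - f x)"
  by (auto simp: bounded_measurable_def)

lemma bounded_measurable_diff:
  "bounded_measurable M f \<Longrightarrow> bounded_measurable M g \<Longrightarrow> bounded_measurable M (\<lambda>x. f x - g x)"
  using bounded_measurable_add[OF _ bounded_measurable_minus] by force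

lemmas bounded_measurable_intros =
  bounded_measurable_add bounded_measurable_diff bounded_measurable_mult

section \<open>Integration against product measures and kernels\<close>

lemma prob_space_kernel:
  assumes "\<kappa> \<in> M \<rightarrow>\<^sub>M prob_algebra N" and "x \<in> space M"
  shows "prob_space (\<kappa> x)" and "sets (\<kappa> x) = sets N" and "space (\<kappa> x) = space N"
  using measurable_space[OF assms] by (auto simp: space_prob_algebra dest: sets_eq_imp_space_eq)

lemma integral_pair_prob:
  assumes P: "prob_space P" and Q: "prob_space Q" and f: "bounded_measurable (P \<Otimes>\<^sub>M Q) f"
  shows "(\<integral>w. f w \<partial>(P \<Otimes>\<^sub>M Q)) = (\<integral>p. \<integral>q. f (p, q) \<partial>Q \<partial>P)"
    and "(\<integral>p. \<integral>q. f (p, q) \<partial>Q \<partial>P) = (\<integral>q. \<integral>p. f (p, q) \<partial>P \<partial>Q)"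
proof -
  interpret P: prob_space P by fact
  interpret Q: prob_space Q by fact
  interpret pair_sigma_finite P Q ..
  have i: "integrable (P \<Otimes>\<^sub>M Q) f"
    by (intro bounded_measurable_integrable prob_space_pair P Q f)
  from integral_fst'[OF i] show "(\<integral>w. f w \<partial>(P \<Otimes>\<^sub>M Q)) = (\<integral>p. \<integral>q. f (p, q) \<partial>Q \<partial>P)" by simp
  show "(\<integral>p. \<integral>q. f (p, q) \<partial>Q \<partial>P) = (\<integral>q. \<integral>p. f (p, q) \<partial>P \<partial>Q)"
    using i by (intro Fubini_integral[symmetric]) simp
qed

text \<open>Two independent copies are exchangeable. This is applied both to a pair of triples and
  to the two points of one fibre.\<close>

lemma integral_pair_swap:
  fixes f :: "'a \<times> 'a \<Rightarrow> real"
  assumes P: "prob_space P" and f: "f \<in> borel_measurable (P \<Otimes>\<^sub>M P)"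
  shows "(\<integral>w. f (snd w, fst w) \<partial>(P \<Otimes>\<^sub>M P)) = (\<integral>w. f w \<partial>(P \<Otimes>\<^sub>M P))"
proof -
  interpret P: prob_space P by fact
  interpret pair_sigma_finite P P ..
  show ?thesis using integral_product_swap[OF f] by (simp add: case_prod_unfold)
qed

text \<open>A uniform variable falls below \<open>h\<close> with probability \<open>h\<close>, so it
  serves as a coin of bias \<open>h\<close>.\<close>

lemma integral_uniform_threshold:
  fixes a b h :: real
  assumes "0 \<le> h" "h \<le> 1"
  shows "(\<integral>s. (if s < h then a else b) \<partial>uniform_measure lborel {0..1}) = b + h * (a - b)"
proof -
  interpret prob_space "uniform_measure lborel {0..1::real}"
    by (rule prob_space_uniform_measure) auto
  have *: "{0..1} \<inter> {..<h} = {0..<h}" using assms by auto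
  have "measure (uniform_measure lborel {0..1}) {..<h} = h"
    using assms by (subst measure_uniform_measure) (auto simp: *)
  moreover have "(\<lambda>s. if s < h then a else b) = (\<lambda>s. b + (a - b) * indicator {..<h} s)"
    by (auto simp: fun_eq_iff)
  moreover have "integrable (uniform_measure lborel {0..1}) (indicator {..<h} :: real \<Rightarrow> real)"
    by (rule integrable_const_bound[where B = 1]) (auto simp: indicator_def)
  ultimately show ?thesis by (simp add: prob_space[simplified])
qed

lemma kernel_joint_in_prob_algebra:
  assumes M: "prob_space M" and \<kappa>: "\<kappa> \<in> M \<rightarrow>\<^sub>M prob_algebra N"
  shows "(\<lambda>x. distr (\<kappa> x) (M \<Otimes>\<^sub>M N) (Pair x)) \<in> M \<rightarrow>\<^sub>M prob_algebra (M \<Otimes>\<^sub>M N)"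
    and "prob_space (kernel_joint M N \<kappa>)" and "sets (kernel_joint M N \<kappa>) = sets (M \<Otimes>\<^sub>M N)"
proof -
  note \<kappa>[measurable]
  show *: "(\<lambda>x. distr (\<kappa> x) (M \<Otimes>\<^sub>M N) (Pair x)) \<in> M \<rightarrow>\<^sub>M prob_algebra (M \<Otimes>\<^sub>M N)"
    by measurable
  have M': "M \<in> space (prob_algebra M)" using M by (simp add: space_prob_algebra)
  show "prob_space (kernel_joint M N \<kappa>)" "sets (kernel_joint M N \<kappa>) = sets (M \<Otimes>\<^sub>M N)"
    unfolding kernel_joint_def by (rule prob_space_bind'[OF M' *] sets_bind'[OF M' *])+
qed

lemma integral_kernel_joint:
  assumes M: "prob_space M" and \<kappa>: "\<kappa> \<in> M \<rightarrow>\<^sub>M prob_algebra N"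
    and f: "bounded_measurable (M \<Otimes>\<^sub>M N) f"
  shows "(\<integral>w. f w \<partial>kernel_joint M N \<kappa>) = (\<integral>x. \<integral>z. f (x, z) \<partial>\<kappa> x \<partial>M)"
proof -
  note K = kernel_joint_in_prob_algebra(1)[OF M \<kappa>]
  interpret M: prob_space M by fact
  from f obtain B where [measurable]: "f \<in> borel_measurable (M \<Otimes>\<^sub>M N)"
    and B: "\<forall>w\<in>space (M \<Otimes>\<^sub>M N). \<bar>f w\<bar> \<le> B" by (auto simp: bounded_measurable_def)
  have "(\<integral>w. f w \<partial>kernel_joint M N \<kappa>) = (\<integral>x. \<integral>w. f w \<partial>distr (\<kappa> x) (M \<Otimes>\<^sub>M N) (Pair x) \<partial>M)"
    unfolding kernel_joint_def
    \<comment> \<open>\<open>B\<close> bounds the integrand, and \<open>B' = 1\<close> the mass of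
      the kernel measures.\<close>
    by (rule integral_bind[where K = "M \<Otimes>\<^sub>M N" and B = B and B' = 1])
      (use B in_space_prob_algebra[OF measurable_space[OF K]] in
        \<open>auto simp: measurable_prob_algebraD[OF K] M.finite_measure_axioms intro!: AE_I2\<close>)
  also have "\<dots> = (\<integral>x. \<integral>z. f (x, z) \<partial>\<kappa> x \<partial>M)"
    by (intro Bochner_Integration.integral_cong refl integral_distr)
      (auto simp: measurable_cong_sets[OF prob_space_kernel(2)[OF \<kappa>] refl])
  finally show ?thesis .
qed

lemma AE_kernel_joint:
  assumes M: "prob_space M" and \<kappa>: "\<kappa> \<in> M \<rightarrow>\<^sub>M prob_algebra N"
    and [measurable]: "Measurable.pred (M \<Otimes>\<^sub>M N) P"
  shows "(AE w in kernel_joint M N \<kappa>. P w) \<longleftrightarrow> (AE x in M. AE z in \<kappa> x. P (x, z))"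
proof -
  note K = kernel_joint_in_prob_algebra(1)[OF M \<kappa>]
  have "(AE w in kernel_joint M N \<kappa>. P w) \<longleftrightarrow>
      (AE x in M. AE w in distr (\<kappa> x) (M \<Otimes>\<^sub>M N) (Pair x). P w)"
    unfolding kernel_joint_def
    by (rule AE_bind[where B = "M \<Otimes>\<^sub>M N"]) (auto simp: measurable_prob_algebraD[OF K])
  also have "\<dots> \<longleftrightarrow> (AE x in M. AE z in \<kappa> x. P (x, z))"
    by (intro AE_cong, subst AE_distr_iff)
      (auto simp: measurable_cong_sets[OF prob_space_kernel(2)[OF \<kappa>] refl])
  finally show ?thesis .
qed

section \<open>Random exchange of fibre points for a general kernel\<close>

text \<open>The argument of \<open>h\<close> is a pair of triples, each made of a first coordinate
  and two points of its fibre; \<open>h\<close> is the probability of exchanging their first fibre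
  points. Symmetry of \<open>h\<close> is assumed only where the second marginal is
  computed.\<close>

locale kernel_swap =
  fixes M :: "'a measure" and N :: "'b measure" and \<kappa> :: "'a \<Rightarrow> 'b measure"
    and h :: "('a \<times> 'b \<times> 'b) \<times> ('a \<times> 'b \<times> 'b) \<Rightarrow> real"
  assumes prob_M: "prob_space M"
    and kernel [measurable]: "\<kappa> \<in> M \<rightarrow>\<^sub>M prob_algebra N"
    and h_measurable [measurable]:
      "h \<in> borel_measurable ((M \<Otimes>\<^sub>M (N \<Otimes>\<^sub>M N)) \<Otimes>\<^sub>M (M \<Otimes>\<^sub>M (N \<Otimes>\<^sub>M N)))"
    and h_nonneg: "0 \<le> h w" and h_le_1: "h w \<le> 1"
begin

abbreviation S :: "('a \<times> 'b \<times> 'b) measure" where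
  "S \<equiv> M \<Otimes>\<^sub>M (N \<Otimes>\<^sub>M N)"

text \<open>Given the first coordinate, the two fibre points are independent. Only the first of them
  is ever moved; the second influences the exchange through \<open>h\<close>.\<close>

definition \<tau> :: "('a \<times> 'b \<times> 'b) measure" where
  "\<tau> = kernel_joint M (N \<Otimes>\<^sub>M N) (\<lambda>x. \<kappa> x \<Otimes>\<^sub>M \<kappa> x)"

text \<open>The uniform variable \<open>s\<close> makes the swap of the first fibre points happen with probability \<open>h\<close>.\<close>

definition swapped_kernel :: "'a \<Rightarrow> 'b measure" where
  "swapped_kernel x =
     distr ((\<kappa> x \<Otimes>\<^sub>M \<kappa> x) \<Otimes>\<^sub>M (\<tau> \<Otimes>\<^sub>M uniform_measure lborel {0..1::real})) N
       (\<lambda>(z, q, s). if s < h ((x, z), q) then fst (snd q) else fst z)"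

lemma kernel_pair [measurable]: "(\<lambda>x. \<kappa> x \<Otimes>\<^sub>M \<kappa> x) \<in> M \<rightarrow>\<^sub>M prob_algebra (N \<Otimes>\<^sub>M N)"
  by measurable

lemma prob_\<tau>: "prob_space \<tau>" and sets_\<tau> [measurable_cong]: "sets \<tau> = sets S"
  unfolding \<tau>_def by (rule kernel_joint_in_prob_algebra[OF prob_M kernel_pair])+

lemma prob_uniform: "prob_space (uniform_measure lborel {0..1::real})"
  by (rule prob_space_uniform_measure) auto

lemma bounded_h: "bounded_measurable (S \<Otimes>\<^sub>M S) h"
  using h_nonneg h_le_1 by (intro bounded_measurableI[where B = 1] h_measurable) auto

lemma integral_\<tau>:
  "bounded_measurable S f \<Longrightarrow> (\<integral>p. f p \<partial>\<tau>) = (\<integral>x. \<integral>z. f (x, z) \<partial>(\<kappa> x \<Otimes>\<^sub>M \<kappa> x) \<partial>M)"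
  unfolding \<tau>_def by (rule integral_kernel_joint[OF prob_M kernel_pair])

text \<open>Exchangeability inside a fibre, integrated over the first coordinate. It is behind both
  the barycentre and the cost computation.\<close>

lemma integral_\<tau>_swap:
  assumes f: "bounded_measurable S f"
  shows "(\<integral>p. f (fst p, snd (snd p), fst (snd p)) \<partial>\<tau>) = (\<integral>p. f p \<partial>\<tau>)"
proof -
  have f': "bounded_measurable S (\<lambda>p. f (fst p, snd (snd p), fst (snd p)))"
    by (rule bounded_measurable_compose[OF _ f]) measurable
  have "(\<integral>z. f (x, snd z, fst z) \<partial>(\<kappa> x \<Otimes>\<^sub>M \<kappa> x)) = (\<integral>z. f (x, z) \<partial>(\<kappa> x \<Otimes>\<^sub>M \<kappa> x))"
    if x: "x \<in> space M" for x
  proof -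
    note [measurable_cong] = prob_space_kernel(2)[OF kernel x]
    note [measurable] = bounded_measurable_measurable[OF f] x
    show ?thesis
      by (rule integral_pair_swap[of "\<kappa> x" "\<lambda>z. f (x, z)"])
        (use prob_space_kernel[OF kernel x] in measurable)
  qed
  then show ?thesis
    unfolding integral_\<tau>[OF f'] integral_\<tau>[OF f]
    by (intro Bochner_Integration.integral_cong[where M = M] refl) simp
qed

lemma swapped_kernel_measurable [measurable]: "swapped_kernel \<in> M \<rightarrow>\<^sub>M prob_algebra N"
proof -
  \<comment> \<open>The second triple and the coin are independent of \<open>x\<close>, so their
    joint law is a constant kernel.\<close>
  have [measurable]: "(\<lambda>x. \<tau> \<Otimes>\<^sub>M uniform_measure lborel {0..1::real})
      \<in> M \<rightarrow>\<^sub>M prob_algebra (S \<Otimes>\<^sub>M borel)"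
    by (rule measurable_const)
      (auto simp: space_prob_algebra prob_space_pair prob_\<tau> prob_uniform sets_\<tau>
        intro!: sets_pair_measure_cong)
  show ?thesis
    unfolding swapped_kernel_def[abs_def]
    by (rule measurable_distr_prob_space2[where M = "(N \<Otimes>\<^sub>M N) \<Otimes>\<^sub>M (S \<Otimes>\<^sub>M borel)"]) measurable
qed

text \<open>Integrating out the coin first turns the random choice between two points into a convex
  combination of the values of \<open>f\<close> there, with weight \<open>h\<close> on the incoming
  point.\<close>

lemma integral_swapped_kernel:
  assumes x: "x \<in> space M" and f: "bounded_measurable N f"
  shows "(\<integral>z. f z \<partial>swapped_kernel x) =
    (\<integral>z. \<integral>q. f (fst z) + h ((x, z), q) * (f (fst (snd q)) - f (fst z)) \<partial>\<tau> \<partial>(\<kappa> x \<Otimes>\<^sub>M \<kappa> x))"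
proof -
  note [measurable_cong] = prob_space_kernel(2)[OF kernel x]
  note [measurable] = bounded_measurable_measurable[OF f] x
  note \<kappa>x = prob_space_kernel[OF kernel x]
  let ?U = "uniform_measure lborel {0..1::real}"
  let ?T = "\<lambda>(z, q, s). if s < h ((x, z), q) then fst (snd q) else fst z"
  have T [measurable]: "?T \<in> (\<kappa> x \<Otimes>\<^sub>M \<kappa> x) \<Otimes>\<^sub>M (\<tau> \<Otimes>\<^sub>M ?U) \<rightarrow>\<^sub>M N"
    by measurable
  have fT: "bounded_measurable ((\<kappa> x \<Otimes>\<^sub>M \<kappa> x) \<Otimes>\<^sub>M (\<tau> \<Otimes>\<^sub>M ?U)) (\<lambda>w. f (?T w))"
    by (rule bounded_measurable_compose[OF T f])
  have "(\<integral>z. f z \<partial>swapped_kernel x) = (\<integral>w. f (?T w) \<partial>((\<kappa> x \<Otimes>\<^sub>M \<kappa> x) \<Otimes>\<^sub>M (\<tau> \<Otimes>\<^sub>M ?U)))"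
    unfolding swapped_kernel_def by (rule integral_distr) measurable
  also have "\<dots> = (\<integral>z. \<integral>v. f (?T (z, v)) \<partial>(\<tau> \<Otimes>\<^sub>M ?U) \<partial>(\<kappa> x \<Otimes>\<^sub>M \<kappa> x))"
    by (rule integral_pair_prob(1)[OF _ _ fT]) (intro prob_space_pair \<kappa>x prob_\<tau> prob_uniform)+
  also have "\<dots> = (\<integral>z. \<integral>q. \<integral>s. f (?T (z, q, s)) \<partial>?U \<partial>\<tau> \<partial>(\<kappa> x \<Otimes>\<^sub>M \<kappa> x))"
  proof (intro Bochner_Integration.integral_cong refl)
    fix z assume [measurable]: "z \<in> space (\<kappa> x \<Otimes>\<^sub>M \<kappa> x)"
    have "bounded_measurable (\<tau> \<Otimes>\<^sub>M ?U) (\<lambda>v. f (?T (z, v)))"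
      by (rule bounded_measurable_compose[OF _ fT]) measurable
    then show "(\<integral>v. f (?T (z, v)) \<partial>(\<tau> \<Otimes>\<^sub>M ?U)) = (\<integral>q. \<integral>s. f (?T (z, q, s)) \<partial>?U \<partial>\<tau>)"
      by (rule integral_pair_prob(1)[OF prob_\<tau> prob_uniform])
  qed
  also have "(\<lambda>z q. \<integral>s. f (?T (z, q, s)) \<partial>?U) =
      (\<lambda>z q. f (fst z) + h ((x, z), q) * (f (fst (snd q)) - f (fst z)))"
    using integral_uniform_threshold[OF h_nonneg h_le_1]
    by (simp add: if_distrib[of f] fun_eq_iff cong: if_cong)
  finally show ?thesis .
qed

abbreviation \<rho> :: "('a \<times> 'b) measure" where
  "\<rho> \<equiv> kernel_joint M N swapped_kernel"

lemma bounded_swap_term: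
  assumes F: "bounded_measurable (M \<Otimes>\<^sub>M N) F"
  shows "bounded_measurable (S \<Otimes>\<^sub>M S)
    (\<lambda>w. h w * (F (fst (fst w), fst (snd (snd w))) - F (fst (fst w), fst (snd (fst w)))))"
  by (intro bounded_measurable_intros bounded_h bounded_measurable_compose[OF _ F]) measurable

lemma integral_\<tau>_marginal:
  assumes F: "bounded_measurable (M \<Otimes>\<^sub>M N) F"
  shows "(\<integral>p. F (fst p, fst (snd p)) \<partial>\<tau>) = (\<integral>w. F w \<partial>kernel_joint M N \<kappa>)"
proof -
  have F': "bounded_measurable S (\<lambda>p. F (fst p, fst (snd p)))"
    by (rule bounded_measurable_compose[OF _ F]) measurable
  have "(\<integral>z. F (x, fst z) \<partial>(\<kappa> x \<Otimes>\<^sub>M \<kappa> x)) = (\<integral>z. F (x, z) \<partial>\<kappa> x)" if x: "x \<in> space M" for x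
  proof -
    note [measurable_cong] = prob_space_kernel(2)[OF kernel x]
    note [measurable] = x
    interpret prob_space "\<kappa> x" by (rule prob_space_kernel[OF kernel x])
    have "bounded_measurable (\<kappa> x \<Otimes>\<^sub>M \<kappa> x) (\<lambda>z. F (x, fst z))"
      by (rule bounded_measurable_compose[OF _ F]) measurable
    from integral_pair_prob(1)[OF prob_space_axioms prob_space_axioms this] show ?thesis
      by (simp add: prob_space)
  qed
  then show ?thesis
    unfolding integral_\<tau>[OF F'] integral_kernel_joint[OF prob_M kernel F]
    by (intro Bochner_Integration.integral_cong[where M = M] refl) simp
qed

text \<open>The last integral is the effect of the exchange. With \<open>F\<close> an indicator of
  the second coordinate it controls the second marginal, and with \<open>F\<close> the cost it is
  the change of total cost.\<close>

lemma integral_\<rho>: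
  assumes F: "bounded_measurable (M \<Otimes>\<^sub>M N) F"
  shows "(\<integral>w. F w \<partial>\<rho>) = (\<integral>w. F w \<partial>kernel_joint M N \<kappa>) +
    (\<integral>w. h w * (F (fst (fst w), fst (snd (snd w))) - F (fst (fst w), fst (snd (fst w)))) \<partial>(\<tau> \<Otimes>\<^sub>M \<tau>))"
proof -
  let ?G = "\<lambda>w. h w * (F (fst (fst w), fst (snd (snd w))) - F (fst (fst w), fst (snd (fst w))))"
  let ?E = "\<lambda>w. F (fst (fst w), fst (snd (fst w)))"
  interpret \<tau>: prob_space \<tau> by (rule prob_\<tau>)
  have G: "bounded_measurable (\<tau> \<Otimes>\<^sub>M \<tau>) ?G"
    using bounded_swap_term[OF F] bounded_measurable_cong_sets[OF sets_pair_measure_cong[OF sets_\<tau> sets_\<tau>]]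
    by blast
  have E: "bounded_measurable (\<tau> \<Otimes>\<^sub>M \<tau>) ?E"
    by (rule bounded_measurable_compose[OF _ F]) measurable
  have E': "bounded_measurable S (\<lambda>p. F (fst p, fst (snd p)))"
    by (rule bounded_measurable_compose[OF _ F]) measurable
  note EG = bounded_measurable_add[OF E G]
  \<comment> \<open>\<open>integral_\<tau>\<close> is to be applied to the integral over
    \<open>q\<close> as a function of \<open>p\<close>, which must therefore be bounded and
    measurable; the bound \<open>B\<close> survives because \<tau> has mass one.\<close>
  have inner: "bounded_measurable S (\<lambda>p. \<integral>q. ?E (p, q) + ?G (p, q) \<partial>\<tau>)"
  proof -
    obtain B where B: "\<forall>w\<in>space (\<tau> \<Otimes>\<^sub>M \<tau>). \<bar>?E w + ?G w\<bar> \<le> B"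
      and [measurable]: "(\<lambda>w. ?E w + ?G w) \<in> borel_measurable (\<tau> \<Otimes>\<^sub>M \<tau>)"
      using EG by (auto simp: bounded_measurable_def)
    show ?thesis
    proof (rule bounded_measurableI)
      have "(\<lambda>p. \<integral>q. ?E (p, q) + ?G (p, q) \<partial>\<tau>) \<in> borel_measurable \<tau>"
        using \<open>(\<lambda>w. ?E w + ?G w) \<in> borel_measurable (\<tau> \<Otimes>\<^sub>M \<tau>)\<close>
        by (intro \<tau>.borel_measurable_lebesgue_integral) (simp add: case_prod_unfold)
      then show "(\<lambda>p. \<integral>q. ?E (p, q) + ?G (p, q) \<partial>\<tau>) \<in> borel_measurable S"
        by (simp cong: measurable_cong_sets add: measurable_cong_sets[OF sets_\<tau> refl])
      fix p assume p: "p \<in> space S"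
      then have [measurable]: "p \<in> space \<tau>" by (simp add: sets_eq_imp_space_eq[OF sets_\<tau>])
      have "bounded_measurable \<tau> (\<lambda>q. ?E (p, q) + ?G (p, q))"
        by (rule bounded_measurable_compose[OF _ EG]) measurable
      then have "integrable \<tau> (\<lambda>q. ?E (p, q) + ?G (p, q))"
        by (rule bounded_measurable_integrable[OF prob_\<tau>])
      then have "\<bar>\<integral>q. ?E (p, q) + ?G (p, q) \<partial>\<tau>\<bar> \<le> (\<integral>q. B \<partial>\<tau>)"
        using B \<open>p \<in> space \<tau>\<close>
        by (intro order_trans[OF integral_abs_bound] integral_mono) (auto simp: space_pair_measure)
      then show "\<bar>\<integral>q. ?E (p, q) + ?G (p, q) \<partial>\<tau>\<bar> \<le> B" by (simp add: \<tau>.prob_space)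
    qed
  qed
  have "(\<integral>w. F w \<partial>\<rho>) = (\<integral>x. \<integral>z. F (x, z) \<partial>swapped_kernel x \<partial>M)"
    by (rule integral_kernel_joint[OF prob_M swapped_kernel_measurable F])
  also have "\<dots> = (\<integral>x. \<integral>z. \<integral>q. ?E ((x, z), q) + ?G ((x, z), q) \<partial>\<tau> \<partial>(\<kappa> x \<Otimes>\<^sub>M \<kappa> x) \<partial>M)"
  proof (intro Bochner_Integration.integral_cong refl)
    fix x assume x [measurable]: "x \<in> space M"
    have "bounded_measurable N (\<lambda>z. F (x, z))"
      by (rule bounded_measurable_compose[OF _ F]) measurable
    from integral_swapped_kernel[OF x this]
    show "(\<integral>z. F (x, z) \<partial>swapped_kernel x) =
        (\<integral>z. \<integral>q. ?E ((x, z), q) + ?G ((x, z), q) \<partial>\<tau> \<partial>(\<kappa> x \<Otimes>\<^sub>M \<kappa> x))"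
      by simp
  qed
  also have "\<dots> = (\<integral>p. \<integral>q. ?E (p, q) + ?G (p, q) \<partial>\<tau> \<partial>\<tau>)"
    by (rule integral_\<tau>[OF inner, symmetric])
  also have "\<dots> = (\<integral>w. ?E w + ?G w \<partial>(\<tau> \<Otimes>\<^sub>M \<tau>))"
    by (rule integral_pair_prob(1)[OF prob_\<tau> prob_\<tau> EG, symmetric])
  also have "\<dots> = (\<integral>w. ?E w \<partial>(\<tau> \<Otimes>\<^sub>M \<tau>)) + (\<integral>w. ?G w \<partial>(\<tau> \<Otimes>\<^sub>M \<tau>))"
    by (intro Bochner_Integration.integral_add bounded_measurable_integrable E G prob_space_pair prob_\<tau>)
  also have "(\<integral>w. ?E w \<partial>(\<tau> \<Otimes>\<^sub>M \<tau>)) = (\<integral>w. F w \<partial>kernel_joint M N \<kappa>)"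
    unfolding integral_pair_prob(1)[OF prob_\<tau> prob_\<tau> E]
    using integral_\<tau>_marginal[OF F] by (simp add: \<tau>.prob_space)
  finally show ?thesis .
qed

lemma distr_fst_kernel_joint:
  assumes K: "K \<in> M \<rightarrow>\<^sub>M prob_algebra N"
  shows "distr (kernel_joint M N K) M fst = M"
proof (rule measure_eqI)
  interpret M: prob_space M by (rule prob_M)
  interpret J: prob_space "kernel_joint M N K"
    by (rule kernel_joint_in_prob_algebra(2)[OF prob_M K])
  note [measurable_cong] = kernel_joint_in_prob_algebra(3)[OF prob_M K]
  interpret D: prob_space "distr (kernel_joint M N K) M fst"
    by (rule J.prob_space_distr) measurable
  fix A assume "A \<in> sets (distr (kernel_joint M N K) M fst)"
  then have A [measurable]: "A \<in> sets M" by simp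
  have *: "bounded_measurable (M \<Otimes>\<^sub>M N) (\<lambda>w. indicator A (fst w))"
    by (rule bounded_measurableI[where B = 1]) (auto simp: indicator_def)
  have "measure (distr (kernel_joint M N K) M fst) A =
      (\<integral>w. indicator A (fst w) \<partial>kernel_joint M N K)"
    by (subst integral_distr[symmetric, where N = M]) auto
  also have "\<dots> = (\<integral>x. \<integral>z. indicator A x \<partial>K x \<partial>M)"
    using integral_kernel_joint[OF prob_M K *] by simp
  also have "\<dots> = (\<integral>x. indicator A x \<partial>M)"
    using prob_space.prob_space[OF prob_space_kernel(1)[OF K]] prob_space_kernel(3)[OF K]
    by (intro Bochner_Integration.integral_cong) auto
  also have "\<dots> = measure M A" by simp
  finally show "emeasure (distr (kernel_joint M N K) M fst) A = emeasure M A"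
    by (simp add: M.emeasure_eq_measure D.emeasure_eq_measure)
qed simp

text \<open>For symmetric \<open>h\<close>, exchanging the two independent triples negates the
  correction term in \<open>integral_\<rho>\<close> and preserves their law. The correction
  therefore vanishes: what one fibre gives away, another receives.\<close>

lemma distr_snd_\<rho>:
  assumes sym: "\<And>w. h (snd w, fst w) = h w"
  shows "distr \<rho> N snd = distr (kernel_joint M N \<kappa>) N snd"
proof (rule measure_eqI)
  have D: "prob_space (distr (kernel_joint M N K) N snd)" if "K \<in> M \<rightarrow>\<^sub>M prob_algebra N" for K
  proof -
    note [measurable_cong] = kernel_joint_in_prob_algebra(3)[OF prob_M that]
    show ?thesis
      by (rule prob_space.prob_space_distr[OF kernel_joint_in_prob_algebra(2)[OF prob_M that]])
        measurable
  qed
  fix A assume "A \<in> sets (distr \<rho> N snd)"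
  then have A [measurable]: "A \<in> sets N" by simp
  let ?F = "\<lambda>w :: 'a \<times> 'b. indicator A (snd w) :: real"
  let ?G = "\<lambda>w. h w * (indicator A (fst (snd (snd w))) - indicator A (fst (snd (fst w))))"
  have F: "bounded_measurable (M \<Otimes>\<^sub>M N) ?F"
    by (rule bounded_measurableI[where B = 1]) (auto simp: indicator_def)
  have [measurable]: "?G \<in> borel_measurable (\<tau> \<Otimes>\<^sub>M \<tau>)" by measurable
  have "(\<integral>w. ?G w \<partial>(\<tau> \<Otimes>\<^sub>M \<tau>)) = (\<integral>w. ?G (snd w, fst w) \<partial>(\<tau> \<Otimes>\<^sub>M \<tau>))"
    by (rule integral_pair_swap[OF prob_\<tau>, symmetric]) measurable
  also have "\<dots> = (\<integral>w. - ?G w \<partial>(\<tau> \<Otimes>\<^sub>M \<tau>))"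
    by (intro Bochner_Integration.integral_cong) (auto simp: sym algebra_simps)
  finally have G0: "(\<integral>w. ?G w \<partial>(\<tau> \<Otimes>\<^sub>M \<tau>)) = 0" by simp
  have mu: "measure (distr (kernel_joint M N K) N snd) A = (\<integral>w. ?F w \<partial>kernel_joint M N K)"
    if "K \<in> M \<rightarrow>\<^sub>M prob_algebra N" for K
  proof -
    note [measurable_cong] = kernel_joint_in_prob_algebra(3)[OF prob_M that]
    show ?thesis by (subst integral_distr[symmetric, where N = N]) auto
  qed
  have "measure (distr \<rho> N snd) A = measure (distr (kernel_joint M N \<kappa>) N snd) A"
    unfolding mu[OF swapped_kernel_measurable] mu[OF kernel] integral_\<rho>[OF F] using G0 by simp
  with D[OF swapped_kernel_measurable] D[OF kernel]
  show "emeasure (distr \<rho> N snd) A = emeasure (distr (kernel_joint M N \<kappa>) N snd) A"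
    by (simp add: finite_measure.emeasure_eq_measure prob_space.finite_measure)
qed simp

end

section \<open>Convex weights of a point between two others\<close>

text \<open>For \<open>y\<close> strictly between \<open>z1\<close> and \<open>z2\<close>,
  \<open>y = weight z1 z2 y * z1 + weight z2 z1 y * z2\<close> is a convex combination; otherwise the weight is \<open>0\<close>.\<close>

definition weight :: "real \<Rightarrow> real \<Rightarrow> real \<Rightarrow> real" where
  "weight z1 z2 y = (if min z1 z2 < y \<and> y < max z1 z2 then (y - z2) / (z1 - z2) else 0)"

lemma weight_between:
  assumes "a < y" "y < b"
  shows "weight a b y = (b - y) / (b - a)" and "weight b a y = (y - a) / (b - a)"
proof -
  have "(y - b) / (a - b) = (b - y) / (b - a)"
    by (metis minus_diff_eq minus_divide_divide)
  then show "weight a b y = (b - y) / (b - a)" using assms by (simp add: weight_def)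
  show "weight b a y = (y - a) / (b - a)" using assms by (simp add: weight_def)
qed

text \<open>The two fibre points come in no particular order. This split reduces claims about
  weights to the ordered case and its mirror image, apart from the trivial case in which both
  weights vanish.\<close>

lemma weight_cases:
  obtains "weight a b y = 0" "weight b a y = 0" "\<not> (min a b < y \<and> y < max a b)"
  | "a < y" "y < b" | "b < y" "y < a"
proof (cases "min a b < y \<and> y < max a b")
  case True
  then show ?thesis using that(2,3) by linarith
next
  case False
  then have "weight a b y = 0" "weight b a y = 0"
    by (simp_all only: weight_def min.commute[of b a] max.commute[of b a] if_False)
  then show ?thesis using that(1) False by blast
qed

lemma weight_bounds: "0 \<le> weight z1 z2 y" "weight z1 z2 y \<le> 1"
proof -
  show "0 \<le> weight z1 z2 y"
    by (cases rule: weight_cases[where a = z1 and b = z2 and y = y]) (simp_all add: weight_between)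
  show "weight z1 z2 y \<le> 1"
    by (cases rule: weight_cases[where a = z1 and b = z2 and y = y]) (simp_all add: weight_between)
qed

text \<open>Moving each endpoint to \<open>y\<close>, in proportion to its weight, causes no net
  displacement, since \<open>y\<close> is the weighted mean of the endpoints; when \<open>y\<close>
  is not strictly between them, both weights are zero.\<close>

lemma weight_barycentre: "weight z1 z2 y * (y - z1) + weight z2 z1 y * (y - z2) = 0"
proof -
  have "(b - y) / (b - a) * (y - a) + (y - a) / (b - a) * (y - b) = 0" for a b :: real
  proof -
    have "(b - y) / (b - a) * (y - a) + (y - a) / (b - a) * (y - b)
        = ((b - y) * (y - a) + (y - a) * (y - b)) / (b - a)"
      by (simp add: add_divide_distrib)
    also have "(b - y) * (y - a) + (y - a) * (y - b) = 0" by (simp add: algebra_simps)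
    finally show ?thesis by simp
  qed
  then have *: "weight a b y * (y - a) + weight b a y * (y - b) = 0" if "a < y" "y < b" for a b
    by (simp only: weight_between[OF that])
  show ?thesis
    using *[of z1 z2] *[of z2 z1]
    by (cases rule: weight_cases[where a = z1 and b = z2 and y = y]) (simp_all only: mult_zero_left add_0_left add.commute)
qed

text \<open>For \<open>y\<close> strictly between, the weights sum to one, so this is strict
  concavity with \<open>g y\<close> moved to the other side. Otherwise both weights vanish, which
  leaves only the weak inequality.\<close>

lemma weight_strictly_concave:
  assumes g: "strictly_concave_on_points Z g" and Z: "z1 \<in> Z" "z2 \<in> Z" "y \<in> Z"
  shows "weight z1 z2 y * (g z1 - g y) + weight z2 z1 y * (g z2 - g y) \<le> 0"
    and "min z1 z2 < y \<Longrightarrow> y < max z1 z2 \<Longrightarrow>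
      weight z1 z2 y * (g z1 - g y) + weight z2 z1 y * (g z2 - g y) < 0"
proof -
  have *: "weight a b y * (g a - g y) + weight b a y * (g b - g y) < 0"
    if ab: "a \<in> Z" "b \<in> Z" and y: "a < y" "y < b" for a b
  proof -
    define t where "t = (y - a) / (b - a)"
    have t: "0 < t" "t < 1" using y by (auto simp: t_def)
    have tab: "t * (b - a) = y - a" using y by (simp add: t_def)
    then have yt: "y = (1 - t) * a + t * b" by (simp add: algebra_simps)
    have "(b - y) / (b - a) = 1 - t" using y by (simp add: t_def diff_divide_eq_iff)
    then have w: "weight a b y = 1 - t" "weight b a y = t"
      using weight_between[OF y] by (simp_all add: t_def)
    have "a < b" "(1 - t) * a + t * b \<in> Z" using y Z(3) unfolding yt[symmetric] by auto
    then have "(1 - t) * g a + t * g b < g ((1 - t) * a + t * b)"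
      using g ab t unfolding strictly_concave_on_points_def by blast
    then show ?thesis unfolding w yt[symmetric] by (simp add: algebra_simps)
  qed
  show "weight z1 z2 y * (g z1 - g y) + weight z2 z1 y * (g z2 - g y) < 0"
    if "min z1 z2 < y" "y < max z1 z2"
  proof (cases rule: weight_cases[where a = z1 and b = z2 and y = y])
    case 1
    with that show ?thesis by blast
  next
    case 2
    then show ?thesis by (rule *[OF Z(1,2)])
  next
    case 3
    then show ?thesis by (subst add.commute) (rule *[OF Z(2,1)])
  qed
  show "weight z1 z2 y * (g z1 - g y) + weight z2 z1 y * (g z2 - g y) \<le> 0"
  proof (cases rule: weight_cases[where a = z1 and b = z2 and y = y])
    case 1
    then show ?thesis by simp
  next
    case 2
    then show ?thesis by (rule *[OF Z(1,2), THEN less_imp_le])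
  next
    case 3
    then show ?thesis by (subst add.commute) (rule *[OF Z(2,1), THEN less_imp_le])
  qed
qed

section \<open>The exchange for real fibres\<close>

text \<open>The fibre points of the first triple enter through \<open>min\<close> and
  \<open>max\<close> because they are unordered; the second triple contributes only its first fibre
  point.\<close>

definition crossing :: "(real \<times> real \<times> real) \<times> (real \<times> real \<times> real) \<Rightarrow> bool" where
  "crossing w \<longleftrightarrow> fst (fst w) < fst (snd w) \<and>
     min (fst (snd (fst w))) (snd (snd (fst w))) < fst (snd (snd w)) \<and>
     fst (snd (snd w)) < max (fst (snd (fst w))) (snd (snd (fst w)))"

definition one_sided :: "(real \<times> real \<times> real) \<times> (real \<times> real \<times> real) \<Rightarrow> real" where
  "one_sided w = (if fst (fst w) < fst (snd w)
     then weight (fst (snd (fst w))) (snd (snd (fst w))) (fst (snd (snd w))) else 0)"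

text \<open>Symmetrised so that the second marginal is preserved.\<close>

definition swap_weight :: "(real \<times> real \<times> real) \<times> (real \<times> real \<times> real) \<Rightarrow> real" where
  "swap_weight w = one_sided w + one_sided (snd w, fst w)"

lemma one_sided_bounds: "0 \<le> one_sided w" "one_sided w \<le> 1"
  by (simp_all add: one_sided_def weight_bounds)

text \<open>The two summands require opposite strict orders of the first coordinates, so at most one
  of them is nonzero.\<close>

lemma swap_weight_bounds: "0 \<le> swap_weight w" "swap_weight w \<le> 1"
  by (simp_all add: swap_weight_def one_sided_def weight_bounds)

lemma swap_weight_commute: "swap_weight (snd w, fst w) = swap_weight w"
  by (simp add: swap_weight_def)

text \<open>Measurability of the identity maps lets Borel conditions on the real line be pulled back
  to \<open>M\<close> and \<open>N\<close>; boundedness on \<open>N\<close> makes the fibres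
  integrable.\<close>

locale real_kernel =
  fixes M N :: "real measure" and \<kappa> :: "real \<Rightarrow> real measure"
  assumes prob: "prob_space M"
    and kernel_in: "\<kappa> \<in> M \<rightarrow>\<^sub>M prob_algebra N"
    and id_M: "(\<lambda>x. x) \<in> borel_measurable M"
    and id_N: "bounded_measurable N (\<lambda>z. z)"
begin

abbreviation SS :: "((real \<times> real \<times> real) \<times> (real \<times> real \<times> real)) measure" where
  "SS \<equiv> (M \<Otimes>\<^sub>M (N \<Otimes>\<^sub>M N)) \<Otimes>\<^sub>M (M \<Otimes>\<^sub>M (N \<Otimes>\<^sub>M N))"

lemma one_sided_measurable: "one_sided \<in> borel_measurable SS"
proof -
  note N = bounded_measurable_measurable[OF id_N]
  have p1: "(\<lambda>w. fst (fst w)) \<in> borel_measurable SS" "(\<lambda>w. fst (snd w)) \<in> borel_measurable SS"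
    by (rule measurable_compose[where N = M, OF _ id_M]; measurable)+
  have p2: "(\<lambda>w. fst (snd (fst w))) \<in> borel_measurable SS"
      "(\<lambda>w. snd (snd (fst w))) \<in> borel_measurable SS"
      "(\<lambda>w. fst (snd (snd w))) \<in> borel_measurable SS"
    by (rule measurable_compose[where N = N, OF _ N]; measurable)+
  note [measurable] = p1 p2
  show ?thesis
    unfolding one_sided_def[abs_def] weight_def by measurable
qed

lemma bounded_one_sided: "bounded_measurable SS one_sided"
  by (rule bounded_measurableI[where B = 1]) (simp_all add: one_sided_measurable one_sided_bounds)

sublocale kernel_swap M N \<kappa> swap_weight
proof (rule kernel_swap.intro)
  have "(\<lambda>w. one_sided (snd w, fst w)) \<in> borel_measurable SS"
    by (rule measurable_compose[OF _ one_sided_measurable]) measurable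
  then show "swap_weight \<in> borel_measurable SS"
    unfolding swap_weight_def[abs_def] using one_sided_measurable by simp
qed (rule prob kernel_in swap_weight_bounds)+

lemma sets_\<tau>\<tau>: "sets (\<tau> \<Otimes>\<^sub>M \<tau>) = sets SS"
  by (intro sets_pair_measure_cong sets_\<tau>)

text \<open>Exchanging the fibre points preserves \<tau> and negates \<open>f\<close>, so the
  integral equals its own negative.\<close>

lemma integral_\<tau>_antisym:
  assumes f: "bounded_measurable S f"
    and anti: "\<And>x z1 z2. f (x, z1, z2) + f (x, z2, z1) = 0"
  shows "(\<integral>p. f p \<partial>\<tau>) = 0"
proof -
  have "(\<integral>p. f p \<partial>\<tau>) = (\<integral>p. f (fst p, snd (snd p), fst (snd p)) \<partial>\<tau>)"
    by (rule integral_\<tau>_swap[OF f, symmetric])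
  also have "\<dots> = (\<integral>p. - f p \<partial>\<tau>)"
    using anti by (intro Bochner_Integration.integral_cong) (auto simp: add_eq_0_iff)
  finally show ?thesis by simp
qed

text \<open>The displacement splits into \<open>?f\<close>, where the fibre over \<open>x\<close>
  surrounds the incoming point, and \<open>?g\<close>, where the other triple surrounds the outgoing
  one. Each averages to zero by \<open>weight_barycentre\<close>, but under a different
  exchange.\<close>

lemma barycentre_swapped_kernel:
  assumes x: "x \<in> space M"
  shows "(\<integral>z. z \<partial>swapped_kernel x) = (\<integral>z. z \<partial>\<kappa> x)"
proof -
  note [measurable_cong] = prob_space_kernel(2)[OF kernel_in x]
  note [measurable] = x
  note \<kappa>x = prob_space_kernel[OF kernel_in x]
  interpret \<tau>: prob_space \<tau> by (rule prob_\<tau>)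
  interpret \<kappa>: prob_space "\<kappa> x" by (rule \<kappa>x)
  let ?K = "\<kappa> x \<Otimes>\<^sub>M \<kappa> x"
  let ?a = "\<lambda>w. fst (fst w) :: real" and ?b = "\<lambda>w. fst (snd (snd w)) - fst (fst w) :: real"
  let ?f = "\<lambda>w. one_sided ((x, fst w), snd w) * ?b w"
  let ?g = "\<lambda>w. one_sided (snd w, (x, fst w)) * ?b w"
  have a: "bounded_measurable (?K \<Otimes>\<^sub>M \<tau>) ?a"
    by (rule bounded_measurable_compose[OF _ id_N]) measurable
  have b: "bounded_measurable (?K \<Otimes>\<^sub>M \<tau>) ?b"
    by (intro bounded_measurable_diff; rule bounded_measurable_compose[OF _ id_N]; measurable)
  have f: "bounded_measurable (?K \<Otimes>\<^sub>M \<tau>) ?f"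
    by (intro bounded_measurable_mult b bounded_measurable_compose[OF _ bounded_one_sided]) measurable
  have g: "bounded_measurable (?K \<Otimes>\<^sub>M \<tau>) ?g"
    by (intro bounded_measurable_mult b bounded_measurable_compose[OF _ bounded_one_sided]) measurable
  have K: "prob_space ?K" by (intro prob_space_pair \<kappa>x)
  note int = bounded_measurable_integrable[OF prob_space_pair[OF K prob_\<tau>]]
  note fub = integral_pair_prob[OF K prob_\<tau>]
  \<comment> \<open>Here the two points over \<open>x\<close> are exchanged, with the other triple
    fixed.\<close>
  have "(\<integral>z. ?f (z, q) \<partial>?K) = 0" if q [measurable]: "q \<in> space \<tau>" for q
  proof -
    have fq: "bounded_measurable ?K (\<lambda>z. ?f (z, q))"
      by (rule bounded_measurable_compose[OF _ f]) measurable
    have "(\<integral>z. ?f (z, q) \<partial>?K) = (\<integral>z. ?f ((snd z, fst z), q) \<partial>?K)"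
      by (rule integral_pair_swap[OF \<kappa>x(1) bounded_measurable_measurable[OF fq], symmetric])
    also have "\<dots> = (\<integral>z. - ?f (z, q) \<partial>?K)"
      using weight_barycentre
      by (intro Bochner_Integration.integral_cong) (auto simp: one_sided_def eq_neg_iff_add_eq_0 add.commute)
    finally show ?thesis by simp
  qed
  then have f0: "(\<integral>w. ?f w \<partial>(?K \<Otimes>\<^sub>M \<tau>)) = 0"
    unfolding fub(1)[OF f] fub(2)[OF f]
    by (subst Bochner_Integration.integral_cong[OF refl, where g = "\<lambda>_. 0"]) auto
  \<comment> \<open>Here the two points of the other triple are exchanged, with those over
    \<open>x\<close> fixed.\<close>
  have "(\<integral>q. ?g (z, q) \<partial>\<tau>) = 0" if [measurable]: "z \<in> space ?K" for z
  proof (rule integral_\<tau>_antisym)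
    have "bounded_measurable \<tau> (\<lambda>q. ?g (z, q))"
      by (rule bounded_measurable_compose[OF _ g]) measurable
    then show "bounded_measurable S (\<lambda>q. ?g (z, q))"
      using bounded_measurable_cong_sets[OF sets_\<tau>] by blast
    show "?g (z, (v, y1, y2)) + ?g (z, (v, y2, y1)) = 0" for v y1 y2
      using weight_barycentre[of y1 y2 "fst z"] by (auto simp: one_sided_def algebra_simps)
  qed
  then have g0: "(\<integral>w. ?g w \<partial>(?K \<Otimes>\<^sub>M \<tau>)) = 0"
    unfolding fub(1)[OF g]
    by (subst Bochner_Integration.integral_cong[OF refl, where g = "\<lambda>_. 0"]) auto
  have "(\<integral>z. z \<partial>swapped_kernel x) = (\<integral>z. \<integral>q. ?a (z, q) + (?f (z, q) + ?g (z, q)) \<partial>\<tau> \<partial>?K)"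
    unfolding integral_swapped_kernel[OF x id_N]
    by (simp add: swap_weight_def distrib_right)
  also have "\<dots> = (\<integral>w. ?a w + (?f w + ?g w) \<partial>(?K \<Otimes>\<^sub>M \<tau>))"
    by (rule fub(1)[symmetric]) (intro bounded_measurable_add a f g)
  also have "\<dots> = (\<integral>w. ?a w \<partial>(?K \<Otimes>\<^sub>M \<tau>))"
    using int[OF a] int[OF f] int[OF g] f0 g0 by simp
  also have "\<dots> = (\<integral>z. fst z \<partial>?K)"
    unfolding fub(1)[OF a] by (simp add: \<tau>.prob_space)
  also have "\<dots> = (\<integral>z. z \<partial>\<kappa> x)"
  proof -
    have "bounded_measurable ?K fst"
      by (rule bounded_measurable_compose[OF _ id_N]) measurable
    from integral_pair_prob(1)[OF \<kappa>x(1) \<kappa>x(1) this] show ?thesis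
      by (simp add: \<kappa>.prob_space)
  qed
  finally show ?thesis .
qed

lemma has_barycentre_swapped_kernel:
  assumes x: "x \<in> space M" and bar: "has_bochner_integral (\<kappa> x) (\<lambda>z. z) m"
  shows "has_bochner_integral (swapped_kernel x) (\<lambda>z. z) m"
proof -
  note \<kappa>' = prob_space_kernel[OF swapped_kernel_measurable x]
  have "bounded_measurable (swapped_kernel x) (\<lambda>z. z)"
    using id_N bounded_measurable_cong_sets[OF \<kappa>'(2)] by blast
  from bounded_measurable_integrable[OF \<kappa>'(1) this] show ?thesis
    using barycentre_swapped_kernel[OF x] has_bochner_integral_integral_eq[OF bar]
    by (simp add: has_bochner_integral_iff)
qed

lemma swapped_barycentric_coupling:
  assumes "kernel_joint M N \<kappa> \<in> couplings M N"
    and "AE x in M. has_bochner_integral (\<kappa> x) (\<lambda>z. z) (F x)"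
  shows "\<rho> \<in> barycentric_couplings F M N"
  unfolding barycentric_couplings_def couplings_def
proof (intro CollectI conjI bexI[of _ swapped_kernel] refl swapped_kernel_measurable)
  show "sets \<rho> = sets (M \<Otimes>\<^sub>M N)"
    by (rule kernel_joint_in_prob_algebra(3)[OF prob swapped_kernel_measurable])
  show "distr \<rho> M fst = M" by (rule distr_fst_kernel_joint[OF swapped_kernel_measurable])
  show "distr \<rho> N snd = N"
    using distr_snd_\<rho>[OF swap_weight_commute] assms(1) by (simp add: couplings_def)
  show "AE x in M. has_bochner_integral (swapped_kernel x) (\<lambda>z. z) (F x)"
    using assms(2) AE_space by eventually_elim (rule has_barycentre_swapped_kernel)
qed

text \<open>Optimality makes the expected cost change nonnegative. Symmetrising over both exchanges
  expresses this change through an integrand of constant sign that is nonzero at every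
  crossing.\<close>

lemma AE_no_crossing:
  assumes c: "bounded_measurable (M \<Otimes>\<^sub>M N) (\<lambda>(x, z). c x z)"
    and msm: "martingale_spence_mirrlees (space M) (space N) c"
    and opt: "(\<integral>(x, z). c x z \<partial>kernel_joint M N \<kappa>) \<le> (\<integral>(x, z). c x z \<partial>\<rho>)"
  shows "AE w in \<tau> \<Otimes>\<^sub>M \<tau>. \<not> crossing w"
proof -
  \<comment> \<open>\<open>?D w\<close> is the cost change over the first triple and
    \<open>?D (snd w, fst w)\<close> that over the second. Their sum is the increment of
    \<open>c v - c x\<close> from \<open>y1\<close> to \<open>z1\<close>, where \<open>x\<close> and
    \<open>v\<close> are the two first coordinates.\<close>
  let ?D = "\<lambda>w :: (real \<times> real \<times> real) \<times> (real \<times> real \<times> real).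
    c (fst (fst w)) (fst (snd (snd w))) - c (fst (fst w)) (fst (snd (fst w)))"
  let ?E = "\<lambda>w. one_sided w * (?D w + ?D (snd w, fst w))"
  let ?\<sigma> = "\<lambda>p :: real \<times> real \<times> real. (fst p, snd (snd p), fst (snd p))"
  note cong = bounded_measurable_cong_sets[OF sets_\<tau>\<tau>]
  note prob2 = prob_space_pair[OF prob_\<tau> prob_\<tau>]
  note int = bounded_measurable_integrable[OF prob2]
  have D: "bounded_measurable SS ?D"
  proof (intro bounded_measurable_diff)
    have "bounded_measurable SS (\<lambda>w. (\<lambda>(x, z). c x z) (fst (fst w), fst (snd (snd w))))"
      by (rule bounded_measurable_compose[OF _ c]) measurable
    then show "bounded_measurable SS (\<lambda>w. c (fst (fst w)) (fst (snd (snd w))))" by simp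
    have "bounded_measurable SS (\<lambda>w. (\<lambda>(x, z). c x z) (fst (fst w), fst (snd (fst w))))"
      by (rule bounded_measurable_compose[OF _ c]) measurable
    then show "bounded_measurable SS (\<lambda>w. c (fst (fst w)) (fst (snd (fst w))))" by simp
  qed
  have sw: "(\<lambda>w. (snd w, fst w)) \<in> SS \<rightarrow>\<^sub>M SS" by measurable
  note D' = bounded_measurable_compose[OF sw D]
  note o = bounded_one_sided
  note o' = bounded_measurable_compose[OF sw o]
  have oD: "bounded_measurable (\<tau> \<Otimes>\<^sub>M \<tau>) (\<lambda>w. one_sided w * ?D w)"
    and oD': "bounded_measurable (\<tau> \<Otimes>\<^sub>M \<tau>) (\<lambda>w. one_sided w * ?D (snd w, fst w))"
    and o'D: "bounded_measurable (\<tau> \<Otimes>\<^sub>M \<tau>) (\<lambda>w. one_sided (snd w, fst w) * ?D w)"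
    and E: "bounded_measurable (\<tau> \<Otimes>\<^sub>M \<tau>) ?E"
    using bounded_measurable_mult[OF o D] bounded_measurable_mult[OF o D']
      bounded_measurable_mult[OF o' D] bounded_measurable_mult[OF o bounded_measurable_add[OF D D']]
    unfolding cong by this+
  have E\<sigma>: "bounded_measurable (\<tau> \<Otimes>\<^sub>M \<tau>) (\<lambda>w. ?E (?\<sigma> (fst w), snd w))"
    by (rule bounded_measurable_compose[OF _ E]) measurable
  have "0 \<le> (\<integral>w. swap_weight w * ?D w \<partial>(\<tau> \<Otimes>\<^sub>M \<tau>))"
    using opt integral_\<rho>[OF c] by simp
  also have "\<dots> = (\<integral>w. one_sided w * ?D w \<partial>(\<tau> \<Otimes>\<^sub>M \<tau>)) +
      (\<integral>w. one_sided (snd w, fst w) * ?D w \<partial>(\<tau> \<Otimes>\<^sub>M \<tau>))"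
    using int[OF oD] int[OF o'D] by (simp add: swap_weight_def distrib_right)
  \<comment> \<open>Exchanging the triples makes both terms carry the same factor
    \<open>one_sided w\<close>.\<close>
  also have "(\<integral>w. one_sided (snd w, fst w) * ?D w \<partial>(\<tau> \<Otimes>\<^sub>M \<tau>)) =
      (\<integral>w. one_sided w * ?D (snd w, fst w) \<partial>(\<tau> \<Otimes>\<^sub>M \<tau>))"
    using integral_pair_swap[OF prob_\<tau> bounded_measurable_measurable[OF oD']] by simp
  also have "(\<integral>w. one_sided w * ?D w \<partial>(\<tau> \<Otimes>\<^sub>M \<tau>)) + \<dots> = (\<integral>w. ?E w \<partial>(\<tau> \<Otimes>\<^sub>M \<tau>))"
    using int[OF oD] int[OF oD'] by (simp add: distrib_left)
  finally have E_nonneg: "0 \<le> (\<integral>w. ?E w \<partial>(\<tau> \<Otimes>\<^sub>M \<tau>))" .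
  \<comment> \<open>Reversing the fibre points of the first triple leaves the integral unchanged, so
    the two orders can be added to produce both weights at once.\<close>
  have "(\<integral>w. ?E (?\<sigma> (fst w), snd w) \<partial>(\<tau> \<Otimes>\<^sub>M \<tau>)) = (\<integral>q. \<integral>p. ?E (?\<sigma> p, q) \<partial>\<tau> \<partial>\<tau>)"
    using integral_pair_prob[OF prob_\<tau> prob_\<tau> E\<sigma>] by simp
  also have "\<dots> = (\<integral>q. \<integral>p. ?E (p, q) \<partial>\<tau> \<partial>\<tau>)"
  proof (rule Bochner_Integration.integral_cong[OF refl])
    fix q assume [measurable]: "q \<in> space \<tau>"
    have "bounded_measurable \<tau> (\<lambda>p. ?E (p, q))"
      by (rule bounded_measurable_compose[OF _ E]) measurable
    then have "bounded_measurable S (\<lambda>p. ?E (p, q))"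
      using bounded_measurable_cong_sets[OF sets_\<tau>] by blast
    from integral_\<tau>_swap[OF this]
    show "(\<integral>p. ?E (?\<sigma> p, q) \<partial>\<tau>) = (\<integral>p. ?E (p, q) \<partial>\<tau>)" by simp
  qed
  also have "\<dots> = (\<integral>w. ?E w \<partial>(\<tau> \<Otimes>\<^sub>M \<tau>))"
    using integral_pair_prob[OF prob_\<tau> prob_\<tau> E] by simp
  finally have E\<sigma>_nonneg: "0 \<le> (\<integral>w. ?E (?\<sigma> (fst w), snd w) \<partial>(\<tau> \<Otimes>\<^sub>M \<tau>))"
    using E_nonneg by simp
  \<comment> \<open>For \<open>x < v\<close> this is the negative of the expression in
    \<open>weight_strictly_concave\<close>, with \<open>g = c v - c x\<close>.\<close>
  let ?H = "\<lambda>w. - (?E w + ?E (?\<sigma> (fst w), snd w))"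
  have H_eq: "?H ((x, z1, z2), (v, y1, y2)) = (if x < v then
      - (weight z1 z2 y1 * ((c v z1 - c x z1) - (c v y1 - c x y1)) +
         weight z2 z1 y1 * ((c v z2 - c x z2) - (c v y1 - c x y1))) else 0)" for x z1 z2 v y1 y2
    by (simp add: one_sided_def algebra_simps)
  have sp: "space (\<tau> \<Otimes>\<^sub>M \<tau>) = (space M \<times> space N \<times> space N) \<times> (space M \<times> space N \<times> space N)"
    using sets_eq_imp_space_eq[OF sets_\<tau>\<tau>] by (simp add: space_pair_measure)
  have concave: "strictly_concave_on_points (space N) (\<lambda>z. c v z - c x z)"
    if "x \<in> space M" "v \<in> space M" "x < v" for x v
    using msm that by (auto simp: martingale_spence_mirrlees_def)
  have H_nonneg: "0 \<le> ?H w" if w: "w \<in> space (\<tau> \<Otimes>\<^sub>M \<tau>)" for w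
  proof -
    obtain x z1 z2 v y1 y2 where [simp]: "w = ((x, z1, z2), (v, y1, y2))"
      by (metis prod.collapse)
    show ?thesis
      using weight_strictly_concave(1)[OF concave, of x v z1 z2 y1] w
      unfolding \<open>w = _\<close> H_eq by (auto simp: sp)
  qed
  have H: "bounded_measurable (\<tau> \<Otimes>\<^sub>M \<tau>) ?H"
    by (intro bounded_measurable_minus bounded_measurable_add E E\<sigma>)
  \<comment> \<open>Optimality bounds the integral from above by zero, concavity from below; hence
    \<open>?H\<close> vanishes almost everywhere, while it is positive at crossings.\<close>
  have "(\<integral>w. ?H w \<partial>(\<tau> \<Otimes>\<^sub>M \<tau>)) \<le> 0"
    using int[OF E] int[OF E\<sigma>] E_nonneg E\<sigma>_nonneg
    by (simp only: Bochner_Integration.integral_minus Bochner_Integration.integral_add)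
  moreover have "0 \<le> (\<integral>w. ?H w \<partial>(\<tau> \<Otimes>\<^sub>M \<tau>))"
    using H_nonneg by (intro integral_nonneg_AE AE_I2)
  ultimately have "(\<integral>w. ?H w \<partial>(\<tau> \<Otimes>\<^sub>M \<tau>)) = 0" by simp
  then have "AE w in \<tau> \<Otimes>\<^sub>M \<tau>. ?H w = 0"
    using integral_nonneg_eq_0_iff_AE[OF int[OF H]] H_nonneg by (auto intro: AE_I2)
  with AE_space show ?thesis
  proof eventually_elim
    case (elim w)
    obtain x z1 z2 v y1 y2 where w: "w = ((x, z1, z2), (v, y1, y2))"
      by (metis prod.collapse)
    show ?case
      using elim(2) weight_strictly_concave(2)[OF concave, of x v z1 z2 y1] elim(1)
      unfolding w H_eq by (auto simp: sp crossing_def)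
  qed
qed

section \<open>From almost sure absence of crossings to the support\<close>

abbreviation \<pi> :: "(real \<times> real) measure" where
  "\<pi> \<equiv> kernel_joint M N \<kappa>"

lemma pred_joint:
  assumes "Measurable.pred (borel \<Otimes>\<^sub>M borel) P"
  shows "Measurable.pred (M \<Otimes>\<^sub>M N) P"
proof -
  have "(\<lambda>w. (fst w, snd w)) \<in> M \<Otimes>\<^sub>M N \<rightarrow>\<^sub>M borel \<Otimes>\<^sub>M borel"
    by (intro measurable_Pair measurable_compose[OF measurable_fst id_M]
        measurable_compose[OF measurable_snd bounded_measurable_measurable[OF id_N]])
  from measurable_compose[OF this assms] show ?thesis by simp
qed

lemma pred_triple:
  assumes "Measurable.pred (borel \<Otimes>\<^sub>M (borel \<Otimes>\<^sub>M borel)) P"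
  shows "Measurable.pred S P"
proof -
  note N = bounded_measurable_measurable[OF id_N]
  have "(\<lambda>p. (fst p, fst (snd p), snd (snd p))) \<in> S \<rightarrow>\<^sub>M borel \<Otimes>\<^sub>M (borel \<Otimes>\<^sub>M borel)"
    by (intro measurable_Pair measurable_compose[OF measurable_fst id_M]
        measurable_compose[OF measurable_snd measurable_compose[OF measurable_fst N]]
        measurable_compose[OF measurable_snd measurable_compose[OF measurable_snd N]])
  from measurable_compose[OF this assms] show ?thesis by simp
qed

lemma AE_\<tau>:
  assumes "Measurable.pred (borel \<Otimes>\<^sub>M (borel \<Otimes>\<^sub>M borel)) P"
  shows "(AE p in \<tau>. P p) \<longleftrightarrow> (AE x in M. AE z in \<kappa> x \<Otimes>\<^sub>M \<kappa> x. P (x, z))"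
  unfolding \<tau>_def by (rule AE_kernel_joint[OF prob kernel_pair pred_triple[OF assms]])

text \<open>By Fubini the condition holds for almost all first and second fibre points; the second
  does not occur in it and ranges over a probability space.\<close>

lemma AE_\<tau>_marginal:
  assumes P: "Measurable.pred (borel \<Otimes>\<^sub>M borel) P" and AE: "AE p in \<tau>. P (fst p, fst (snd p))"
  shows "AE w in \<pi>. P w"
proof -
  have "Measurable.pred (borel \<Otimes>\<^sub>M (borel \<Otimes>\<^sub>M borel)) (\<lambda>p. P (fst p, fst (snd p)))"
    by (rule measurable_compose[OF _ P]) measurable
  from iffD1[OF AE_\<tau>[OF this] AE]
  have "AE x in M. AE z in \<kappa> x \<Otimes>\<^sub>M \<kappa> x. P (x, fst z)" by simp
  with AE_space have "AE x in M. AE z in \<kappa> x. P (x, z)"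
  proof eventually_elim
    case (elim x)
    interpret \<kappa>: prob_space "\<kappa> x" by (rule prob_space_kernel[OF kernel_in elim(1)])
    interpret pair_sigma_finite "\<kappa> x" "\<kappa> x" ..
    from AE_pair[OF elim(2)] show ?case by simp
  qed
  then show ?thesis by (simp add: AE_kernel_joint[OF prob kernel_in pred_joint[OF P]])
qed

text \<open>The form in which support points are used: an almost sure statement that avoids a
  neighbourhood of such a point is absurd.\<close>

lemma not_AE_outside_support:
  assumes p: "p \<in> measure_support \<pi>" and U: "open U" "p \<in> U"
    and AE: "AE w in \<pi>. w \<notin> U"
  shows False
proof -
  have pos: "emeasure \<pi> (U \<inter> space \<pi>) > 0"
    using p U by (auto simp: measure_support_def)
  have "- U \<in> sets borel" using U(1) by (intro borel_closed) auto
  then have "Measurable.pred (borel \<Otimes>\<^sub>M borel) (\<lambda>w. w \<notin> U)"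
    by (simp add: borel_prod pred_def Compl_eq)
  then have "Measurable.pred (M \<Otimes>\<^sub>M N) (\<lambda>w. w \<notin> U)" by (rule pred_joint)
  then have "Measurable.pred \<pi> (\<lambda>w. w \<notin> U)"
    by (simp add: measurable_cong_sets[OF kernel_joint_in_prob_algebra(3)[OF prob kernel_in] refl])
  then have "{w \<in> space \<pi>. \<not> w \<notin> U} \<in> sets \<pi>" by measurable
  then have "emeasure \<pi> {w \<in> space \<pi>. \<not> w \<notin> U} = 0"
    using AE_iff_measurable[OF _ refl, of \<pi> "\<lambda>w. w \<notin> U"] AE by blast
  moreover have "{w \<in> space \<pi>. \<not> w \<notin> U} = U \<inter> space \<pi>" by blast
  ultimately show False using pos by simp
qed

text \<open>The sign \<open>e\<close> treats the part of the support above the barycentre and its mirror image at once.\<close>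

lemma no_crossing_in_support:
  assumes nc: "AE w in \<tau> \<Otimes>\<^sub>M \<tau>. \<not> crossing w"
    and bar: "AE x in M. has_bochner_integral (\<kappa> x) (\<lambda>z. z) m"
    and e: "e = 1 \<or> e = (- 1 :: real)"
    and p: "(x, z) \<in> measure_support \<pi>" and p': "(x', z') \<in> measure_support \<pi>"
    and less: "x < x'" "e * m \<le> e * z'" "e * z' < e * z"
  shows False
proof -
  \<comment> \<open>Midpoints: \<open>t\<close> separates the two first coordinates and
    \<open>s\<close> the two signed second coordinates.\<close>
  define t s where "t = (x + x') / 2" and "s = (e * z + e * z') / 2"
  have ts: "x < t" "t < x'" "e * z' < s" "s < e * z" using less by (auto simp: t_def s_def field_simps)
  interpret \<tau>: prob_space \<tau> by (rule prob_\<tau>)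
  interpret \<tau>\<tau>: pair_sigma_finite \<tau> \<tau> ..
  \<comment> \<open>A triple violating this would cross every triple whose first pair lies in
    \<open>?U\<close>. The margin \<open>1 / Suc n\<close> leaves room for
    \<open>e * m = e * z'\<close>: it keeps \<open>?U\<close> an open neighbourhood of
    \<open>(x', z')\<close>.\<close>
  have cross: "AE p in \<tau>. \<not> (fst p < t \<and> e * fst (snd p) < e * m - 1 / Suc n \<and> s < e * snd (snd p))" for n
    using \<tau>\<tau>.AE_pair[OF nc]
  proof eventually_elim
    case (elim p)
    show ?case
    proof
      assume p: "fst p < t \<and> e * fst (snd p) < e * m - 1 / Suc n \<and> s < e * snd (snd p)"
      let ?U = "{w :: real \<times> real. t < fst w \<and> e * m - 1 / Suc n < e * snd w \<and> e * snd w < s}"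
      have "open ?U"
        by (intro open_Collect_conj open_Collect_less continuous_intros)
      moreover have "0 < 1 / real (Suc n)" by simp
      then have "e * m - 1 / Suc n < e * z'" using less(2) by linarith
      then have "(x', z') \<in> ?U" using ts by (simp del: of_nat_Suc)
      moreover have "AE w in \<pi>. w \<notin> ?U"
      proof (rule AE_\<tau>_marginal)
        show "Measurable.pred (borel \<Otimes>\<^sub>M borel) (\<lambda>w. w \<notin> ?U)" by measurable
        from elim show "AE q in \<tau>. (fst q, fst (snd q)) \<notin> ?U"
        proof eventually_elim
          case (elim q)
          with p e show ?case by (auto simp: crossing_def min_def max_def split: if_splits)
        qed
      qed
      ultimately show False by (rule not_AE_outside_support[OF p'])
    qed
  qed
  \<comment> \<open>The margin is removed by taking all \<open>n\<close> together.\<close>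
  have "AE p in \<tau>. \<not> (fst p < t \<and> e * fst (snd p) < e * m \<and> s < e * snd (snd p))"
  proof -
    have "AE p in \<tau>. \<forall>n. \<not> (fst p < t \<and> e * fst (snd p) < e * m - 1 / Suc n \<and> s < e * snd (snd p))"
      by (subst AE_all_countable) (intro allI cross)
    then show ?thesis
    proof eventually_elim
      case (elim p)
      show ?case
      proof
        assume *: "fst p < t \<and> e * fst (snd p) < e * m \<and> s < e * snd (snd p)"
        then have "0 < e * m - e * fst (snd p)" by simp
        from reals_Archimedean[OF this] obtain n where "1 / Suc n < e * m - e * fst (snd p)"
          unfolding inverse_eq_divide by blast
        then have "e * fst (snd p) < e * m - 1 / Suc n" by linarith
        with * elim show False by blast
      qed
    qed
  qed
  moreover have "Measurable.pred (borel \<Otimes>\<^sub>M (borel \<Otimes>\<^sub>M borel))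
      (\<lambda>p. \<not> (fst p < t \<and> e * fst (snd p) < e * m \<and> s < e * snd (snd p)))"
    by measurable
  ultimately have "AE x in M. AE z in \<kappa> x \<Otimes>\<^sub>M \<kappa> x. \<not> (x < t \<and> e * fst z < e * m \<and> s < e * snd z)"
    using AE_\<tau>[of "\<lambda>p. \<not> (fst p < t \<and> e * fst (snd p) < e * m \<and> s < e * snd (snd p))"] by simp
  with bar AE_space have "AE x in M. AE z in \<kappa> x. \<not> (x < t \<and> s < e * z)"
  proof eventually_elim
    case (elim x)
    interpret \<kappa>: prob_space "\<kappa> x" by (rule prob_space_kernel[OF kernel_in elim(2)])
    interpret \<kappa>\<kappa>: pair_sigma_finite "\<kappa> x" "\<kappa> x" ..
    have AE2: "AE z1 in \<kappa> x. AE z2 in \<kappa> x. \<not> (x < t \<and> e * z1 < e * m \<and> s < e * z2)"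
      using \<kappa>\<kappa>.AE_pair[OF elim(3)] by simp
    show ?case
    proof (rule ccontr)
      assume contra: "\<not> (AE z in \<kappa> x. \<not> (x < t \<and> s < e * z))"
      \<comment> \<open>If the fibre charges the part above \<open>s\<close>, pairing such points
        with \<open>z1\<close> shows that almost no \<open>z1\<close> lies on the far side of
        \<open>m\<close>.\<close>
      from AE2 have "AE z1 in \<kappa> x. e * m \<le> e * z1"
      proof eventually_elim
        case (elim z1)
        show ?case
        proof (rule ccontr)
          assume "\<not> e * m \<le> e * z1"
          with elim have "AE z2 in \<kappa> x. \<not> (x < t \<and> s < e * z2)" by auto
          with contra show False by simp
        qed
      qed
      \<comment> \<open>A fibre with mean \<open>m\<close> lying on one side of \<open>m\<close> is
        concentrated at \<open>m\<close>. But \<open>e * m \<le> e * z' < s\<close>, so it cannot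
        charge the part above \<open>s\<close>.\<close>
      moreover have int: "integrable (\<kappa> x) (\<lambda>z. z)" and "(\<integral>z. z \<partial>\<kappa> x) = m"
        using elim(1) by (auto simp: has_bochner_integral_iff)
      then have "(\<integral>z. e * z - e * m \<partial>\<kappa> x) = 0" by (simp add: \<kappa>.prob_space)
      moreover have "integrable (\<kappa> x) (\<lambda>z. e * z - e * m)" using int by simp
      ultimately have "AE z in \<kappa> x. e * z - e * m = 0"
        by (subst integral_nonneg_eq_0_iff_AE[symmetric]) auto
      then have "AE z in \<kappa> x. \<not> (x < t \<and> s < e * z)"
        by eventually_elim (use ts less in auto)
      with contra show False by simp
    qed
  qed
  moreover have "Measurable.pred (borel \<Otimes>\<^sub>M borel) (\<lambda>w. \<not> (fst w < t \<and> s < e * snd w))"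
    by measurable
  \<comment> \<open>The excluded set is an open neighbourhood of \<open>(x, z)\<close>, which
    contradicts membership in the support.\<close>
  ultimately have "AE w in \<pi>. w \<notin> {w. fst w < t \<and> s < e * snd w}"
    using AE_kernel_joint[OF prob kernel_in pred_joint, of "\<lambda>w. \<not> (fst w < t \<and> s < e * snd w)"]
    by simp
  moreover have "open {w :: real \<times> real. fst w < t \<and> s < e * snd w}"
    by (intro open_Collect_conj open_Collect_less continuous_intros)
  moreover have "(x, z) \<in> {w. fst w < t \<and> s < e * snd w}" using ts by simp
  ultimately show False by (intro not_AE_outside_support[OF p])
qed

text \<open>One of the two points over \<open>x\<close> suffices: the upper one if \<open>z'\<close>
  is at or above the barycentre, and otherwise the lower one, after reflection.\<close>

lemma left_monotone_joint:
  assumes nc: "AE w in \<tau> \<Otimes>\<^sub>M \<tau>. \<not> crossing w"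
    and bar: "AE x in M. has_bochner_integral (\<kappa> x) (\<lambda>z. z) m"
  shows "left_monotone \<pi>"
  unfolding left_monotone_def left_monotone_set_def
proof (intro allI impI notI)
  fix x z1 z2 x' z'
  assume *: "(x, z1) \<in> measure_support \<pi> \<and> (x, z2) \<in> measure_support \<pi> \<and>
    (x', z') \<in> measure_support \<pi> \<and> z1 < z2 \<and> x < x'" and "z' \<in> {z1<..<z2}"
  then have z': "z1 < z'" "z' < z2" by auto
  note no_crossing = no_crossing_in_support[OF nc bar]
  show False
  proof (cases "m \<le> z'")
    case True
    with no_crossing[of 1 x z2 x' z'] * z' show False by simp
  next
    case False
    with no_crossing[of "- 1" x z1 x' z'] * z' show False by simp
  qed
qed

end

section \<open>Continuous costs on compact sets and the minimiser\<close>

lemma bounded_measurable_continuous_on_compact: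
  fixes c :: "real \<Rightarrow> real \<Rightarrow> real"
  assumes X: "compact X" and Z: "compact Z" and c: "continuous_on (X \<times> Z) (\<lambda>(x, z). c x z)"
  shows "bounded_measurable (restrict_space borel X \<Otimes>\<^sub>M restrict_space borel Z) (\<lambda>(x, z). c x z)"
proof -
  let ?P = "restrict_space borel X \<Otimes>\<^sub>M restrict_space borel Z"
  \<comment> \<open>Extension by zero makes the cost Borel on the plane; measurability on the
    product of the restricted spaces is then obtained by pulling back.\<close>
  let ?f = "\<lambda>w. indicator (X \<times> Z) w *\<^sub>R (\<lambda>(x, z). c x z) w"
  have "X \<times> Z \<in> sets borel" using X Z by (intro borel_closed compact_imp_closed compact_Times)
  then have "?f \<in> borel_measurable (borel \<Otimes>\<^sub>M borel)"
    using c unfolding borel_prod by (rule borel_measurable_continuous_on_indicator)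
  moreover have "(\<lambda>w. (fst w, snd w)) \<in> ?P \<rightarrow>\<^sub>M borel \<Otimes>\<^sub>M borel"
    by (intro measurable_Pair measurable_compose[OF measurable_fst measurable_restrict_space1]
        measurable_compose[OF measurable_snd measurable_restrict_space1]) measurable
  ultimately have "(\<lambda>w. ?f (fst w, snd w)) \<in> borel_measurable ?P"
    by (rule measurable_compose[rotated])
  moreover have "?f (fst w, snd w) = (\<lambda>(x, z). c x z) w" if "w \<in> space ?P" for w
    using that by (auto simp: space_pair_measure space_restrict_space)
  ultimately have "(\<lambda>(x, z). c x z) \<in> borel_measurable ?P"
    by (subst measurable_cong[where g = "\<lambda>w. ?f (fst w, snd w)"]) auto
  moreover have "bounded ((\<lambda>(x, z). c x z) ` (X \<times> Z))"
    using X Z c by (intro compact_imp_bounded compact_continuous_image compact_Times)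
  then obtain B where "\<forall>w \<in> X \<times> Z. \<bar>(\<lambda>(x, z). c x z) w\<bar> \<le> B"
    by (auto simp: bounded_iff)
  ultimately show ?thesis
    by (intro bounded_measurableI[where B = B]) (auto simp: space_pair_measure space_restrict_space)
qed

theorem theorem3p5:
  fixes X Z :: "real set"
    and \<sigma>X \<sigma>Z :: "real measure"
    and c :: "real \<Rightarrow> real \<Rightarrow> real"
    and \<pi> :: "(real \<times> real) measure"
  assumes "compact X" and "compact Z"
    and "\<sigma>X \<in> borel_probs X" and "\<sigma>Z \<in> borel_probs Z"
    and "continuous_on (X \<times> Z) (\<lambda>(x, z). c x z)"
    and "\<And>z. z \<in> Z \<Longrightarrow> (\<lambda>x. c x z) differentiable_on X"
    and "martingale_spence_mirrlees X Z c"
    and "is_arg_min (\<lambda>\<rho>. \<integral>(x, z). c x z \<partial>\<rho>)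
           (\<lambda>\<rho>. \<rho> \<in> barycentric_couplings (\<lambda>x. \<integral>z. z \<partial>\<sigma>Z) \<sigma>X \<sigma>Z) \<pi>"
  shows "left_monotone \<pi>"
proof -
  have X: "prob_space \<sigma>X" "sets \<sigma>X = sets (restrict_space borel X)" "space \<sigma>X = X"
    and Z: "prob_space \<sigma>Z" "sets \<sigma>Z = sets (restrict_space borel Z)" "space \<sigma>Z = Z"
    using assms(3,4)
    by (auto simp: borel_probs_def space_prob_algebra space_restrict_space dest: sets_eq_imp_space_eq)
  let ?m = "\<integral>z. z \<partial>\<sigma>Z"
  have opt: "\<pi> \<in> barycentric_couplings (\<lambda>x. ?m) \<sigma>X \<sigma>Z"
    "\<And>\<rho>. \<rho> \<in> barycentric_couplings (\<lambda>x. ?m) \<sigma>X \<sigma>Z \<Longrightarrow> (\<integral>(x, z). c x z \<partial>\<pi>) \<le> (\<integral>(x, z). c x z \<partial>\<rho>)"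
    using assms(8) by (auto simp: is_arg_min_def not_less)
  from opt(1) obtain \<kappa> where \<kappa>: "\<kappa> \<in> \<sigma>X \<rightarrow>\<^sub>M prob_algebra \<sigma>Z"
    and \<pi>: "\<pi> = kernel_joint \<sigma>X \<sigma>Z \<kappa>" "\<pi> \<in> couplings \<sigma>X \<sigma>Z"
    and bar: "AE x in \<sigma>X. has_bochner_integral (\<kappa> x) (\<lambda>z. z) ?m"
    unfolding barycentric_couplings_def by blast
  obtain B where B: "\<And>z. z \<in> Z \<Longrightarrow> \<bar>z\<bar> \<le> B"
    using compact_imp_bounded[OF assms(2)] by (auto simp: bounded_iff)
  interpret real_kernel \<sigma>X \<sigma>Z \<kappa>
  proof (rule real_kernel.intro)
    show "prob_space \<sigma>X" by (fact X)
    show "\<kappa> \<in> \<sigma>X \<rightarrow>\<^sub>M prob_algebra \<sigma>Z" by (fact \<kappa>)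
    show "(\<lambda>x. x) \<in> borel_measurable \<sigma>X"
      unfolding measurable_cong_sets[OF X(2) refl] by (intro measurable_restrict_space1) simp
    have "(\<lambda>z. z) \<in> borel_measurable \<sigma>Z"
      unfolding measurable_cong_sets[OF Z(2) refl] by (intro measurable_restrict_space1) simp
    then show "bounded_measurable \<sigma>Z (\<lambda>z. z)"
      using B by (intro bounded_measurableI[where B = B]) (simp_all add: Z)
  qed
  have "bounded_measurable (\<sigma>X \<Otimes>\<^sub>M \<sigma>Z) (\<lambda>(x, z). c x z)"
    using bounded_measurable_continuous_on_compact[OF assms(1,2,5)]
    unfolding bounded_measurable_cong_sets[OF sets_pair_measure_cong[OF X(2) Z(2)]] .
  moreover have "martingale_spence_mirrlees (space \<sigma>X) (space \<sigma>Z) c"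
    using assms(7) by (simp add: X Z)
  \<comment> \<open>The coupling after the exchange is an admissible competitor, so minimality
    supplies the cost inequality.\<close>
  moreover have "kernel_joint \<sigma>X \<sigma>Z swapped_kernel \<in> barycentric_couplings (\<lambda>x. ?m) \<sigma>X \<sigma>Z"
    using \<pi>(2) unfolding \<pi>(1) by (rule swapped_barycentric_coupling[OF _ bar])
  then have "(\<integral>(x, z). c x z \<partial>kernel_joint \<sigma>X \<sigma>Z \<kappa>)
      \<le> (\<integral>(x, z). c x z \<partial>kernel_joint \<sigma>X \<sigma>Z swapped_kernel)"
    unfolding \<pi>(1)[symmetric] by (rule opt(2))
  ultimately show ?thesis
    unfolding \<pi>(1) by (intro left_monotone_joint[OF AE_no_crossing bar])
qed

end
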